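(* Consider the time-invariant nonlinear discrete-time system $x(i+1)=f(x(i))$, $i=0,1,2,\dots$, where $f$ is continuously differentiable with Jacobian $J(x):=\frac{\partial}{\partial x}f(x)$, and whose trajectories evolve on a convex and compact set $\Omega\subset\mathbb{R}^n$ (that is, $f(\Omega)\subseteq\Omega$). Suppose that the matrix $\int_0^1 J(ra+(1-r)b)\,\mathrm{d}r$ is totally positive for any $a,b\in\Omega$. Then any solution (with initial condition in $\Omega$) converges to an equilibrium point, i.e., to a point $e\in\Omega$ with $f(e)=e$.
   Context: A matrix is totally positive (TP) if all its minors (of all orders) are positive. Here $f$ is taken to be an $\mathbb{R}^n$-valued, continuously differentiable map on an open set containing $\Omega$. *)

theory Defs
  imports "HOL-Analysis.Analysis" "Jordan_Normal_Form.Determinant"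
begin

(* Both parents use $ for vector components and define a constant det.  Here $ is the component of
   a vector in real ^ 'n; the order k of a minor is a number, not a type, so its determinant has
   to be the one for matrices of variable size. *)
no_notation vec_index (infixl \<open>$\<close> 100)

definition minor ::
  "real ^ 'n ^ 'm \<Rightarrow> nat \<Rightarrow> (nat \<Rightarrow> 'm::finite) \<Rightarrow> (nat \<Rightarrow> 'n::finite) \<Rightarrow> real" where
  "minor A k r c = Determinant.det (Matrix.mat k k (\<lambda>(i, j). A $ r i $ c j))"

(* The rows and columns r 0 < ... < r (k - 1) and c 0 < ... < c (k - 1) are taken in increasing
   order, whence the linorder on the index types.  Orders k > min CARD('m) CARD('n) admit no such
   r or c. *)
definition totally_positive ::
  "real ^ ('n::{finite,linorder}) ^ ('m::{finite,linorder}) \<Rightarrow> bool" where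
  "totally_positive A \<longleftrightarrow>
     (\<forall>k r c. 1 \<le> k \<and> strict_mono_on {..<k} r \<and> strict_mono_on {..<k} c \<longrightarrow> minor A k r c > 0)"

end

theory Submission
  imports Defs
begin

text \<open>The differences \<open>z\<^sub>i = x (i + 1) - x i\<close> satisfy \<open>z\<^sub>i\<^sub>+\<^sub>1 = A\<^sub>i z\<^sub>i\<close> with \<open>A\<^sub>i\<close> totally positive, by the
  integral form of the mean value theorem. Totally positive matrices diminish the sign variation of
  vectors, even when zeros of the image are given the most favourable signs; hence the first
  coordinate of \<open>z\<^sub>i\<close> eventually has a constant nonzero sign, and the first coordinate of \<open>x\<close> is
  eventually monotone and converges to some \<open>L\<close>. The orbit of a limit point \<open>p\<close> consists of limit
  points, so its first coordinate is constantly \<open>L\<close>, and the same sign argument shows that \<open>p\<close> is an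
  equilibrium. The difference of two distinct equilibria is fixed by a totally positive matrix and
  so has a nonzero first coordinate; therefore there is only one limit point.\<close>

section \<open>Increasing enumerations in linear orders\<close>

lemma finite_linorder_enumeration:
  fixes S :: "'a::linorder set"
  assumes "finite S"
  shows "\<exists>c::nat \<Rightarrow> 'a. strict_mono_on {..<card S} c \<and> c ` {..<card S} = S"
  using assms
proof (induction S rule: finite_linorder_max_induct)
  case empty
  then show ?case by (auto simp: strict_mono_on_def)
next
  case (insert b S)
  then obtain c :: "nat \<Rightarrow> 'a" where c: "strict_mono_on {..<card S} c" "c ` {..<card S} = S"
    by blast
  have b: "b \<notin> S" using insert by auto
  have lt: "c q < b" if "q < card S" for q
    using c(2) insert(2) that by blast
  have "strict_mono_on {..<Suc (card S)} (c(card S := b))"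
    using c(1) lt by (auto simp: strict_mono_on_def less_Suc_eq)
  moreover have "(c(card S := b)) ` {..<Suc (card S)} = insert b S"
    using c(2) by (auto simp: lessThan_Suc)
  moreover have "card (insert b S) = Suc (card S)" using b insert(1) by simp
  ultimately show ?case by metis
qed

text \<open>The witness \<open>p\<close> counts the entries below \<open>l\<close>. It is the
  position at which \<open>l\<close> can be inserted, and its parity later fixes the sign attached
  to \<open>l\<close>.\<close>

lemma strict_mono_on_gap:
  fixes c :: "nat \<Rightarrow> 'a::linorder"
  assumes "strict_mono_on {..<k} c" and "l \<notin> c ` {..<k}"
  shows "\<exists>p\<le>k. (\<forall>q<p. c q < l) \<and> (\<forall>q. p \<le> q \<and> q < k \<longrightarrow> l < c q)"
  using assms
proof (induction k)
  case 0
  then show ?case by auto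
next
  case (Suc k)
  have "strict_mono_on {..<k} c" "l \<notin> c ` {..<k}"
    using Suc.prems by (auto simp: lessThan_Suc intro: monotone_on_subset)
  with Suc.IH obtain p where p: "p \<le> k" "\<forall>q<p. c q < l" "\<forall>q. p \<le> q \<and> q < k \<longrightarrow> l < c q"
    by blast
  show ?case
  proof (cases "l < c k")
    case True
    then show ?thesis using p by (intro exI[of _ p]) (auto simp: less_Suc_eq)
  next
    case False
    then have "c k < l" using Suc.prems(2) by (metis image_eqI lessThan_iff lessI linorder_neqE)
    then have "\<forall>q<Suc k. c q < l"
      using Suc.prems(1) unfolding strict_mono_on_def
      by (metis lessThan_iff lessI less_SucE order.strict_trans less_Suc_eq)
    then show ?thesis by (intro exI[of _ "Suc k"]) auto
  qed
qed

subsection \<open>Row combinations with a prescribed sign pattern\<close>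

text \<open>Laplace expansion along the inserted column: deleting it restores the columns
  \<open>c\<close>, so the coefficients of the entries \<open>A $ r j $ l\<close> depend on neither
  \<open>l\<close> nor, up to the common sign, \<open>p\<close>. The column \<open>l\<close> may
  repeat one of the \<open>c q\<close>.\<close>

lemma minor_insert_column:
  fixes A :: "real ^ ('n::finite) ^ ('m::finite)"
  assumes "p \<le> k"
  shows "minor A (Suc k) r (\<lambda>q. if q < p then c q else if q = p then l else c (q - 1)) =
    (-1) ^ p * (\<Sum>j\<le>k. (-1) ^ j * minor A k (\<lambda>i. r (if i < j then i else Suc i)) c * A $ r j $ l)"
    (is "minor A _ r ?c = _")
proof -
  define M where "M = Matrix.mat (Suc k) (Suc k) (\<lambda>(i, j). A $ r i $ ?c j)"
  have M: "M \<in> carrier_mat (Suc k) (Suc k)" by (simp add: M_def)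
  have del: "mat_delete M j p =
      Matrix.mat k k (\<lambda>(i, q). A $ r (if i < j then i else Suc i) $ c q)" for j
    by (rule eq_matI) (auto simp: mat_delete_def M_def)
  have entry: "M $$ (j, p) = A $ r j $ l" if "j < Suc k" for j
    using that assms by (simp add: M_def)
  have "minor A (Suc k) r ?c = (\<Sum>j<Suc k. M $$ (j, p) * cofactor M j p)"
    unfolding minor_def M_def[symmetric] using laplace_expansion_column[OF M, of p] assms by simp
  also have "\<dots> = (\<Sum>j<Suc k. (-1) ^ p * ((-1) ^ j *
      minor A k (\<lambda>i. r (if i < j then i else Suc i)) c * A $ r j $ l))"
    by (intro sum.cong refl) (simp add: cofactor_def del minor_def entry power_add)
  finally show ?thesis
    by (simp add: sum_distrib_left lessThan_Suc_atMost)
qed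

text \<open>The coefficients are the cofactors of a column inserted into the given \<open>k\<close> columns, so the
  combination of the rows vanishes in these columns and changes its sign at each of them.\<close>

lemma totally_positive_row_combination:
  fixes A :: "real ^ ('n::{finite,linorder}) ^ ('m::{finite,linorder})"
  assumes "totally_positive A"
    and r: "strict_mono_on {..<Suc k} r" and c: "strict_mono_on {..<k} c"
  obtains C :: "nat \<Rightarrow> real" and d :: "'n \<Rightarrow> real" where
    "\<And>j. j \<le> k \<Longrightarrow> C j > 0"
    "\<And>z. (\<Sum>j\<le>k. (-1) ^ j * C j * (A *v z) $ r j) = (\<Sum>l\<in>UNIV. d l * z $ l)"
    "\<And>q. q < k \<Longrightarrow> d (c q) = 0"
    "\<And>l p. p \<le> k \<Longrightarrow> \<forall>q<p. c q < l \<Longrightarrow> \<forall>q. p \<le> q \<and> q < k \<longrightarrow> l < c q \<Longrightarrow> (-1) ^ p * d l > 0"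
proof
  let ?C = "\<lambda>j. minor A k (\<lambda>i. r (if i < j then i else Suc i)) c"
  let ?d = "\<lambda>l. \<Sum>j\<le>k. (-1) ^ j * ?C j * A $ r j $ l"
  let ?ins = "\<lambda>p l q. if q < p then c q else if q = p then l else c (q - 1)"
  show "?C j > 0" if "j \<le> k" for j
  proof (cases "k = 0")
    \<comment> \<open>\<open>totally_positive\<close> speaks of orders from 1 on; the empty minor is
      1 by definition.\<close>
    case True
    then show ?thesis by (simp add: minor_def)
  next
    case False
    have "strict_mono_on {..<k} (\<lambda>i. r (if i < j then i else Suc i))"
      using r by (auto simp: strict_mono_on_def)
    then show ?thesis using assms False by (auto simp: totally_positive_def)
  qed
  show "(\<Sum>j\<le>k. (-1) ^ j * ?C j * (A *v z) $ r j) = (\<Sum>l\<in>UNIV. ?d l * z $ l)" for z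
    unfolding matrix_vector_mult_def sum_distrib_left sum_distrib_right vec_lambda_beta
    by (subst sum.swap) (simp add: mult.assoc)
  show "?d (c q) = 0" if "q < k" for q
  proof -
    \<comment> \<open>Inserting \<open>c q\<close> in front moves the old copy to position
      \<open>Suc q\<close>, so two columns coincide.\<close>
    define M where "M = Matrix.mat (Suc k) (Suc k) (\<lambda>(i, j). A $ r i $ ?ins 0 (c q) j)"
    have "Determinant.det M = 0"
    proof (rule det_identical_columns)
      show "Matrix.col M 0 = Matrix.col M (Suc q)"
        using that by (intro eq_vecI) (auto simp: M_def)
    qed (use that in \<open>auto simp: M_def\<close>)
    then have "minor A (Suc k) r (?ins 0 (c q)) = 0"
      by (simp only: minor_def M_def)
    then show ?thesis using minor_insert_column[of 0 k A r c "c q"] by simp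
  qed
  show "(-1) ^ p * ?d l > 0"
    if "p \<le> k" "\<forall>q<p. c q < l" "\<forall>q. p \<le> q \<and> q < k \<longrightarrow> l < c q" for l p
  proof -
    have "?ins p l i < ?ins p l j" if "i < j" "j < Suc k" for i j
    proof -
      have "c i < c j" if "i < j" "j < k" for i j
        using c that by (auto simp: strict_mono_on_def)
      then show ?thesis using that \<open>p \<le> k\<close> \<open>\<forall>q<p. c q < l\<close> \<open>\<forall>q. p \<le> q \<and> q < k \<longrightarrow> l < c q\<close>
        by (cases j) auto
    qed
    then have "strict_mono_on {..<Suc k} (?ins p l)"
      unfolding strict_mono_on_def by simp
    then have "minor A (Suc k) r (?ins p l) > 0"
      using assms by (simp add: totally_positive_def)
    then show ?thesis using minor_insert_column[OF that(1), of A r c l] by simp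
  qed
qed

text \<open>Combining all rows so that every column but \<open>l\<close> is cancelled leaves a
  nonzero multiple of \<open>z $ l\<close>, as in Cramer's rule.\<close>

lemma totally_positive_mult_nonzero:
  fixes A :: "real ^ ('n::{finite,linorder}) ^ ('n::{finite,linorder})"
  assumes "totally_positive A" and "z \<noteq> 0"
  shows "A *v z \<noteq> 0"
proof
  assume 0: "A *v z = 0"
  have "z $ l = 0" for l
  proof -
    define k where "k = card (UNIV - {l})"
    have card: "card (UNIV :: 'n set) = Suc k"
      unfolding k_def by (rule card.remove) auto
    obtain r where r: "strict_mono_on {..<Suc k} (r :: nat \<Rightarrow> 'n)"
      using finite_linorder_enumeration[of "UNIV :: 'n set"] card by auto
    obtain c where c: "strict_mono_on {..<k} c" "c ` {..<k} = UNIV - {l}"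
      using finite_linorder_enumeration[of "UNIV - {l}"] by (auto simp: k_def)
    obtain C d where "\<And>j. j \<le> k \<Longrightarrow> C j > 0" and
      sum: "\<And>z. (\<Sum>j\<le>k. (-1) ^ j * C j * (A *v z) $ r j) = (\<Sum>l\<in>UNIV. d l * z $ l)" and
      d: "\<And>q. q < k \<Longrightarrow> d (c q) = 0"
        "\<And>l p. p \<le> k \<Longrightarrow> \<forall>q<p. c q < l \<Longrightarrow> \<forall>q. p \<le> q \<and> q < k \<longrightarrow> l < c q \<Longrightarrow>
          (-1) ^ p * d l > 0"
      by (rule totally_positive_row_combination[OF assms(1) r c(1)]) blast
    have "d l \<noteq> 0"
      using strict_mono_on_gap[OF c(1), of l] c(2) d(2)[of _ l]
      by (metis DiffD2 insertI1 less_irrefl mult_zero_right)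
    moreover have "d l' = 0" if "l' \<noteq> l" for l'
    proof -
      have "l' \<in> c ` {..<k}" using that c(2) by simp
      then show ?thesis using d(1) by auto
    qed
    then have "(\<Sum>l'\<in>UNIV. d l' * z $ l') = d l * z $ l"
      by (subst sum.remove[of _ l]) auto
    ultimately show ?thesis using sum[of z] 0 by simp
  qed
  then show False using assms(2) by (simp add: Finite_Cartesian_Product.vec_eq_iff)
qed

subsection \<open>Variation diminution\<close>

text \<open>For \<open>v \<noteq> 0\<close>, the largest \<open>m\<close> over
  \<open>\<tau> = 1\<close> and \<open>\<tau> = -1\<close> is one more than the number of sign
  changes of \<open>v\<close> with zeros discarded. In \<open>weak_alt\<close>, zeros may be given
  either sign. The sign \<open>\<tau>\<close> of the first entry is kept because the pattern itself,
  not only its length, is inherited.\<close>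

definition strict_alt :: "real \<Rightarrow> nat \<Rightarrow> real ^ ('n::{finite,linorder}) \<Rightarrow> bool" where
  "strict_alt \<tau> m v \<longleftrightarrow> (\<exists>c. strict_mono_on {..<m} c \<and> (\<forall>q<m. \<tau> * (-1) ^ q * v $ c q > 0))"

definition weak_alt :: "real \<Rightarrow> nat \<Rightarrow> real ^ ('n::{finite,linorder}) \<Rightarrow> bool" where
  "weak_alt \<tau> m v \<longleftrightarrow> (\<exists>c. strict_mono_on {..<m} c \<and> (\<forall>q<m. \<tau> * (-1) ^ q * v $ c q \<ge> 0))"

lemma strict_alt_imp_weak_alt: "strict_alt \<tau> m v \<Longrightarrow> weak_alt \<tau> m v"
  unfolding strict_alt_def weak_alt_def by (meson less_imp_le)

lemma strict_alt_le_card: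
  fixes v :: "real ^ ('n::{finite,linorder})"
  assumes "strict_alt \<tau> m v"
  shows "m \<le> CARD('n)"
proof -
  obtain c :: "nat \<Rightarrow> 'n" where "strict_mono_on {..<m} c"
    using assms by (auto simp: strict_alt_def)
  then have "inj_on c {..<m}" by (rule strict_mono_on_imp_inj_on)
  then show ?thesis using card_inj_on_le[of c "{..<m}" UNIV] by simp
qed

text \<open>Scanning the entries in increasing order and recording each entry whose sign is opposite to
  the last recorded one (the first must have sign \<open>\<tau>\<close>) gives \<open>c\<close>.\<close>

lemma greedy_alternation:
  fixes v :: "real ^ ('n::{finite,linorder})"
  obtains m c where "strict_mono_on {..<m} c" "\<And>q. q < m \<Longrightarrow> \<tau> * (-1) ^ q * v $ c q > 0"
    "\<And>l p. p \<le> m \<Longrightarrow> \<forall>q<p. c q < l \<Longrightarrow> \<forall>q. p \<le> q \<and> q < m \<longrightarrow> l < c q \<Longrightarrow>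
       \<tau> * (-1) ^ p * v $ l \<le> 0"
proof -
  \<comment> \<open>The claim is relativised to a finite \<open>S\<close>, so that the scan becomes
    induction by adding a new maximum.\<close>
  define Q where "Q S m c \<longleftrightarrow> strict_mono_on {..<m} c \<and> c ` {..<m} \<subseteq> S \<and>
      (\<forall>q<m. \<tau> * (-1) ^ q * v $ c q > 0) \<and>
      (\<forall>l\<in>S. \<forall>p\<le>m. (\<forall>q<p. c q < l) \<longrightarrow> (\<forall>q. p \<le> q \<and> q < m \<longrightarrow> l < c q) \<longrightarrow>
        \<tau> * (-1) ^ p * v $ l \<le> 0)" for S m and c :: "nat \<Rightarrow> 'n"
  have "\<exists>m c. Q S m c" if "finite S" for S
    using that
  proof (induction S rule: finite_linorder_max_induct)
    case empty
    have "Q {} 0 c" for c by (simp add: Q_def strict_mono_on_def)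
    then show ?case by blast
  next
    case (insert b S)
    then obtain m c where Q: "Q S m c" by blast
    from Q have mono: "strict_mono_on {..<m} c" and sub: "c ` {..<m} \<subseteq> S" and
      pos: "\<forall>q<m. \<tau> * (-1) ^ q * v $ c q > 0" and
      le: "\<And>l p. l \<in> S \<Longrightarrow> p \<le> m \<Longrightarrow> \<forall>q<p. c q < l \<Longrightarrow> \<forall>q. p \<le> q \<and> q < m \<longrightarrow> l < c q \<Longrightarrow>
        \<tau> * (-1) ^ p * v $ l \<le> 0"
      unfolding Q_def by simp_all
    have lt: "c q < b" if "q < m" for q
      using sub insert(2) that by blast
    show ?case
    proof (cases "\<tau> * (-1) ^ m * v $ b > 0")
      case False
      have "\<tau> * (-1) ^ p * v $ l \<le> 0" if "l \<in> insert b S" "p \<le> m" "\<forall>q<p. c q < l"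
        "\<forall>q. p \<le> q \<and> q < m \<longrightarrow> l < c q" for l p
      proof (cases "l = b")
        case True
        \<comment> \<open>As \<open>b\<close> exceeds all recorded entries, it can only lie in the
          last gap.\<close>
        then have "p = m" using that lt by (metis le_neq_implies_less less_asym order_refl)
        then show ?thesis using False True by simp
      next
        case False
        then show ?thesis using that le by blast
      qed
      then have "Q (insert b S) m c" using mono sub pos unfolding Q_def by auto
      then show ?thesis by blast
    next
      case True
      let ?c = "c(m := b)"
      have "strict_mono_on {..<Suc m} ?c"
        using mono lt by (auto simp: strict_mono_on_def less_Suc_eq)
      moreover have "?c ` {..<Suc m} \<subseteq> insert b S"
        using sub by (auto simp: image_subset_iff less_Suc_eq)
      moreover have "\<forall>q<Suc m. \<tau> * (-1) ^ q * v $ ?c q > 0"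
        using pos True by (auto simp: less_Suc_eq)
      moreover have "\<tau> * (-1) ^ p * v $ l \<le> 0" if l: "l \<in> insert b S" and p: "p \<le> Suc m"
        and lo: "\<forall>q<p. ?c q < l" and hi: "\<forall>q. p \<le> q \<and> q < Suc m \<longrightarrow> l < ?c q" for l p
      proof -
        have "l \<le> b" using l insert(2) by auto
        \<comment> \<open>The new last gap lies above \<open>b\<close> and is empty, so only the old
          gaps remain to be checked.\<close>
        have "p \<le> m"
          using p lo \<open>l \<le> b\<close> by (metis fun_upd_same le_Suc_eq lessI not_le)
        then have "l < b" using hi by (metis fun_upd_same lessI)
        then have "l \<in> S" using l by auto
        moreover have "\<forall>q<p. c q < l" using lo \<open>p \<le> m\<close> by (metis fun_upd_other not_less)
        moreover have "\<forall>q. p \<le> q \<and> q < m \<longrightarrow> l < c q"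
          using hi by (metis fun_upd_other less_SucI less_irrefl)
        ultimately show ?thesis using le \<open>p \<le> m\<close> by blast
      qed
      ultimately have "Q (insert b S) (Suc m) ?c" unfolding Q_def by simp
      then show ?thesis by blast
    qed
  qed
  from this[of UNIV] obtain m c where "Q UNIV m c" by auto
  then show thesis using that[of m c] unfolding Q_def by simp
qed

text \<open>If the greedy selection for \<open>z\<close> stops at \<open>m < k\<close>, the row
  combination built on it equates, after multiplication by \<open>\<tau>\<close>, a sum of
  nonnegative terms from \<open>A *v z\<close> with a sum of nonpositive terms from
  \<open>z\<close>. All terms vanish, so \<open>A *v z\<close> is zero in \<open>m + 1\<close> rows
  while \<open>z\<close> is supported on \<open>m\<close> columns; this contradicts the choice of
  \<open>c 0\<close>, or \<open>z \<noteq> 0\<close> when \<open>m = 0\<close>.\<close>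

lemma totally_positive_variation_diminishing:
  fixes A :: "real ^ ('n::{finite,linorder}) ^ ('m::{finite,linorder})"
  assumes A: "totally_positive A" and z: "z \<noteq> 0" and \<tau>: "\<tau> \<noteq> 0" and alt: "weak_alt \<tau> k (A *v z)"
  shows "strict_alt \<tau> k z"
proof (rule ccontr)
  assume not: "\<not> strict_alt \<tau> k z"
  obtain m c where c: "strict_mono_on {..<m} c"
    and pos: "\<And>q. q < m \<Longrightarrow> \<tau> * (-1) ^ q * z $ c q > 0"
    and le: "\<And>l p. p \<le> m \<Longrightarrow> \<forall>q<p. c q < l \<Longrightarrow> \<forall>q. p \<le> q \<and> q < m \<longrightarrow> l < c q \<Longrightarrow>
       \<tau> * (-1) ^ p * z $ l \<le> 0"
    by (rule greedy_alternation[of \<tau> z]) blast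
  have "m < k"
  proof (rule ccontr)
    assume "\<not> m < k"
    then have "strict_mono_on {..<k} c" "\<forall>q<k. \<tau> * (-1) ^ q * z $ c q > 0"
      using c pos by (auto simp: strict_mono_on_def)
    with not show False by (auto simp: strict_alt_def)
  qed
  obtain r where "strict_mono_on {..<k} r" and rk: "\<forall>q<k. \<tau> * (-1) ^ q * (A *v z) $ r q \<ge> 0"
    using alt by (auto simp: weak_alt_def)
  then have r: "strict_mono_on {..<Suc m} r"
    using \<open>m < k\<close> by (auto simp: strict_mono_on_def)
  obtain C d where C: "\<And>j. j \<le> m \<Longrightarrow> C j > 0"
    and sum: "\<And>z. (\<Sum>j\<le>m. (-1) ^ j * C j * (A *v z) $ r j) = (\<Sum>l\<in>UNIV. d l * z $ l)"
    and d0: "\<And>q. q < m \<Longrightarrow> d (c q) = 0"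
    and d: "\<And>l p. p \<le> m \<Longrightarrow> \<forall>q<p. c q < l \<Longrightarrow> \<forall>q. p \<le> q \<and> q < m \<longrightarrow> l < c q \<Longrightarrow>
        (-1) ^ p * d l > 0"
    by (rule totally_positive_row_combination[OF A r c]) blast
  have gap: "\<exists>p\<le>m. (-1) ^ p * d l > 0 \<and> \<tau> * (-1) ^ p * z $ l \<le> 0" if "l \<notin> c ` {..<m}" for l
    using strict_mono_on_gap[OF c that] le d by metis
  have le0: "\<tau> * (d l * z $ l) \<le> 0" for l
  proof (cases "l \<in> c ` {..<m}")
    case True
    then show ?thesis using d0 by auto
  next
    case False
    then obtain p where "(-1) ^ p * d l > 0" "\<tau> * (-1) ^ p * z $ l \<le> 0" using gap by blast
    then have "((-1) ^ p * d l) * (\<tau> * (-1) ^ p * z $ l) \<le> 0"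
      by (simp add: mult_nonneg_nonpos)
    also have "((-1) ^ p * d l) * (\<tau> * (-1) ^ p * z $ l) = \<tau> * (d l * z $ l) * ((-1) ^ p * (-1) ^ p)"
      by (simp only: ac_simps)
    also have "\<dots> = \<tau> * (d l * z $ l)" by (simp flip: power_mult_distrib)
    finally show ?thesis .
  qed
  have ge0: "C j * (\<tau> * (-1) ^ j * (A *v z) $ r j) \<ge> 0" if "j \<le> m" for j
    using C[OF that] rk that \<open>m < k\<close> by simp
  have eq: "(\<Sum>j\<le>m. C j * (\<tau> * (-1) ^ j * (A *v z) $ r j)) = (\<Sum>l\<in>UNIV. \<tau> * (d l * z $ l))"
    using arg_cong[OF sum[of z], of "\<lambda>s. \<tau> * s"] by (simp add: sum_distrib_left ac_simps)
  have "(\<Sum>l\<in>UNIV. \<tau> * (d l * z $ l)) \<le> 0" using le0 by (intro sum_nonpos) auto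
  moreover have "(\<Sum>j\<le>m. C j * (\<tau> * (-1) ^ j * (A *v z) $ r j)) \<ge> 0"
    using ge0 by (intro sum_nonneg) auto
  ultimately have zero: "(\<Sum>j\<le>m. C j * (\<tau> * (-1) ^ j * (A *v z) $ r j)) = 0"
      "(\<Sum>l\<in>UNIV. - (\<tau> * (d l * z $ l))) = 0"
    using eq by (auto simp: sum_negf)
  have Az0: "(A *v z) $ r j = 0" if "j \<le> m" for j
  proof -
    have "C j * (\<tau> * (-1) ^ j * (A *v z) $ r j) = 0"
      using zero(1) ge0 that by (subst (asm) sum_nonneg_eq_0_iff) auto
    then show ?thesis using C[OF that] \<tau> by simp
  qed
  have z0: "z $ l = 0" if "l \<notin> c ` {..<m}" for l
  proof -
    have "- (\<tau> * (d l * z $ l)) = 0"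
      using zero(2) le0 by (subst (asm) sum_nonneg_eq_0_iff) auto
    then show ?thesis using gap[OF that] \<tau> by auto
  qed
  show False
  proof (cases m)
    case 0
    then show False using z0 z by (simp add: Finite_Cartesian_Product.vec_eq_iff)
  next
    case (Suc m')
    text \<open>The entries of \<open>A *v z\<close> in \<open>m\<close> rows vanish, and \<open>z\<close> is supported on the \<open>m\<close> columns \<open>c\<close>;
      a row combination vanishing in all of these columns but the first isolates \<open>z $ c 0\<close>.\<close>
    have r': "strict_mono_on {..<Suc m'} r" and c': "strict_mono_on {..<m'} (\<lambda>q. c (Suc q))"
      using r c by (auto simp: strict_mono_on_def Suc)
    obtain C' d' where "\<And>j. j \<le> m' \<Longrightarrow> C' j > 0" and
      sum': "\<And>z. (\<Sum>j\<le>m'. (-1) ^ j * C' j * (A *v z) $ r j) = (\<Sum>l\<in>UNIV. d' l * z $ l)"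
      and d'0: "\<And>q. q < m' \<Longrightarrow> d' (c (Suc q)) = 0"
      and d': "\<And>l p. p \<le> m' \<Longrightarrow> \<forall>q<p. c (Suc q) < l \<Longrightarrow>
          \<forall>q. p \<le> q \<and> q < m' \<longrightarrow> l < c (Suc q) \<Longrightarrow> (-1) ^ p * d' l > 0"
      by (rule totally_positive_row_combination[OF A r' c']) blast
    \<comment> \<open>The column \<open>c 0\<close> lies in gap 0 of the remaining columns, so its
      coefficient is positive.\<close>
    have "c 0 < c (Suc q)" if "q < m'" for q
      using c that by (auto simp: strict_mono_on_def Suc)
    then have "d' (c 0) > 0" using d'[of 0 "c 0"] by simp
    have rest: "d' l * z $ l = 0" if "l \<noteq> c 0" for l
    proof (cases "l \<in> c ` {..<m}")
      case True
      then obtain q where "q < m" "l = c q" by blast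
      with that Suc obtain q' where "q = Suc q'" "q' < m'" by (cases q) auto
      then show ?thesis using d'0 \<open>l = c q\<close> by simp
    next
      case False
      then show ?thesis using z0 by simp
    qed
    have "(\<Sum>l\<in>UNIV. d' l * z $ l) = d' (c 0) * z $ c 0"
      by (subst sum.remove[of _ "c 0"]) (auto simp: rest)
    moreover have "(\<Sum>l\<in>UNIV. d' l * z $ l) = 0"
      using sum'[of z] Az0 Suc by simp
    ultimately have "z $ c 0 = 0" using \<open>d' (c 0) > 0\<close> by simp
    then show False using pos[of 0] Suc by simp
  qed
qed

subsection \<open>The first coordinate along products of totally positive matrices\<close>

lemma decseq_finite_sets_eventually_constant:
  fixes T :: "nat \<Rightarrow> 'a set"
  assumes "finite (T 0)" and "\<And>i. T (Suc i) \<subseteq> T i"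
  obtains N where "\<And>i. N \<le> i \<Longrightarrow> T i = T N"
proof -
  have anti: "T j \<subseteq> T i" if "i \<le> j" for i j
    using lift_Suc_antimono_le[of T, OF assms(2) that] .
  obtain N where N: "\<And>i. card (T N) \<le> card (T i)"
    using ex_has_least_nat[of "\<lambda>_. True" 0 "\<lambda>i. card (T i)"] by auto
  have "finite (T N)" using anti[of 0 N] assms(1) finite_subset by blast
  then have "T i = T N" if "N \<le> i" for i
    using card_seteq[OF _ anti[OF that] N] by blast
  then show thesis by (rule that)
qed

text \<open>The set of alternation patterns of \<open>z i\<close> decreases with \<open>i\<close>. Once it is constant, weak and
  strict patterns of \<open>z i\<close> agree, and prepending the first coordinate to a longest pattern with the
  opposite initial sign would give a longer one.\<close>

lemma first_coordinate_eventually_signed: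
  fixes z :: "nat \<Rightarrow> real ^ ('n::{finite,linorder})"
    and A :: "nat \<Rightarrow> real ^ ('n::{finite,linorder}) ^ ('n::{finite,linorder})"
  assumes A: "\<And>i. totally_positive (A i)" and step: "\<And>i. z (Suc i) = A i *v z i"
    and "z 0 \<noteq> 0"
  obtains \<sigma> N where "\<sigma> \<in> {1, -1}" "\<And>i. N \<le> i \<Longrightarrow> \<sigma> * z i $ Min UNIV > 0"
proof -
  define T where "T i = {(\<tau>, m). \<tau> \<in> {1, -1} \<and> strict_alt \<tau> m (z i)}" for i
  have nz: "z i \<noteq> 0" for i
    using assms(3) totally_positive_mult_nonzero[OF A] step by (induction i) auto
  have weak: "strict_alt \<tau> m (z i)" if "\<tau> \<in> {1, -1}" "weak_alt \<tau> m (z (Suc i))" for \<tau> m i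
    using totally_positive_variation_diminishing[OF A nz, of \<tau> m i i] that step by auto
  have "T i \<subseteq> {1, -1} \<times> {..CARD('n)}" for i
    using strict_alt_le_card by (auto simp: T_def)
  then have "finite (T 0)" by (rule finite_subset) simp
  moreover have "T (Suc i) \<subseteq> T i" for i
    using weak strict_alt_imp_weak_alt by (fastforce simp: T_def)
  ultimately obtain N where N: "\<And>i. N \<le> i \<Longrightarrow> T i = T N"
    by (rule decseq_finite_sets_eventually_constant) blast
  have stable: "strict_alt \<tau> m (z i) \<longleftrightarrow> strict_alt \<tau> m (z N)"
    if "\<tau> \<in> {1, -1}" "N \<le> i" for \<tau> m i
    using N[OF that(2)] that(1) unfolding T_def set_eq_iff by blast
  define P where "P m \<longleftrightarrow> (\<exists>\<tau>\<in>{1, -1}. strict_alt \<tau> m (z N))" for m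
  have bound: "\<And>m. P m \<Longrightarrow> m \<le> CARD('n)" using strict_alt_le_card by (auto simp: P_def)
  have "P 1"
  proof -
    obtain l where "z N $ l \<noteq> 0"
      using nz[of N] by (auto simp: Finite_Cartesian_Product.vec_eq_iff)
    moreover have "strict_alt \<tau> 1 (z N)" if "\<tau> * z N $ l > 0" for \<tau>
      unfolding strict_alt_def using that by (intro exI[of _ "\<lambda>_. l"]) (auto simp: strict_mono_on_def)
    ultimately show ?thesis unfolding P_def
      by (metis insertCI linorder_neqE_linordered_idom mult_1 mult_minus1 neg_0_less_iff_less)
  qed
  define M where "M = (GREATEST m. P m)"
  have "P M" unfolding M_def using GreatestI_nat[of P 1] \<open>P 1\<close> bound by blast
  have max: "m \<le> M" if "P m" for m
    unfolding M_def using Greatest_le_nat[of P m] that bound by blast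
  have "M \<ge> 1" using max \<open>P 1\<close> by blast
  obtain \<sigma> where \<sigma>: "\<sigma> \<in> {1, -1}" "strict_alt \<sigma> M (z N)"
    using \<open>P M\<close> by (auto simp: P_def)
  \<comment> \<open>The index is \<open>Suc i\<close> because a weak pattern of
    \<open>z (Suc i)\<close> yields a strict one for \<open>z i\<close>, which must itself lie in
    the stable range.\<close>
  have "\<sigma> * z (Suc i) $ Min UNIV > 0" if "N \<le> i" for i
  proof (rule ccontr)
    assume neg: "\<not> \<sigma> * z (Suc i) $ Min UNIV > 0"
    obtain c where c: "strict_mono_on {..<M} c" "\<And>q. q < M \<Longrightarrow> \<sigma> * (-1) ^ q * z (Suc i) $ c q > 0"
      using stable[of \<sigma> "Suc i" M] \<sigma> \<open>N \<le> i\<close> by (auto simp: strict_alt_def)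
    let ?c = "\<lambda>q. if q = 0 then Min UNIV else c (q - 1)"
    \<comment> \<open>The entry at \<open>c 0\<close> has sign \<open>\<sigma>\<close> and the first
      coordinate does not, so prepending really adds an index.\<close>
    have "c 0 \<noteq> Min UNIV" using c(2)[of 0] \<open>M \<ge> 1\<close> neg by auto
    then have c0: "Min UNIV < c 0" by (simp add: order.not_eq_order_implies_strict)
    have "Min UNIV < c q" if "q < M" for q
    proof (cases "q = 0")
      case False
      then have "c 0 < c q" using c(1) that by (auto simp: strict_mono_on_def)
      with c0 show ?thesis by (rule order.strict_trans)
    qed (use c0 in simp)
    moreover have "c q < c q'" if "q < q'" "q' < M" for q q'
      using c(1) that by (auto simp: strict_mono_on_def)
    ultimately have "strict_mono_on {..<Suc M} ?c"
      unfolding strict_mono_on_def by (auto simp: less_diff_conv)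
    moreover have "- \<sigma> * (-1) ^ q * z (Suc i) $ ?c q \<ge> 0" if "q < Suc M" for q
    proof (cases q)
      case 0
      then show ?thesis using neg by simp
    next
      case (Suc q')
      then show ?thesis using c(2)[of q'] that by simp
    qed
    ultimately have "weak_alt (- \<sigma>) (Suc M) (z (Suc i))"
      unfolding weak_alt_def by blast
    moreover have \<sigma>': "- \<sigma> \<in> {1, -1}" using \<sigma>(1) by auto
    ultimately have "strict_alt (- \<sigma>) (Suc M) (z i)" using weak by blast
    then have "P (Suc M)"
      unfolding P_def using stable[OF \<sigma>' \<open>N \<le> i\<close>] \<sigma>' by blast
    then show False using max by fastforce
  qed
  then have "\<sigma> * z i $ Min UNIV > 0" if "Suc N \<le> i" for i
    using that by (cases i) auto
  then show thesis using that \<sigma>(1) by blast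
qed

subsection \<open>Convergence\<close>

text \<open>The fundamental theorem of calculus along the segment from \<open>b\<close> to
  \<open>a\<close>; applying a matrix to \<open>a - b\<close> is bounded linear in the matrix and so
  commutes with the integral.\<close>

lemma mean_value_integral_jacobian:
  fixes f :: "real ^ 'n \<Rightarrow> real ^ 'm"
  assumes U: "open U" "f differentiable_on U" "continuous_on U (\<lambda>y. jacobian f (at y))"
    and ab: "closed_segment b a \<subseteq> U"
  shows "f a - f b =
    integral {0..1} (\<lambda>r::real. jacobian f (at (r *\<^sub>R a + (1 - r) *\<^sub>R b))) *v (a - b)"
proof -
  define g where "g r = r *\<^sub>R a + (1 - r) *\<^sub>R b" for r :: real
  let ?J = "\<lambda>r. jacobian f (at (g r))"
  have gU: "g r \<in> U" if "r \<in> {0..1}" for r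
    using ab that by (force simp: g_def closed_segment_def add.commute)
  have deriv: "((f \<circ> g) has_vector_derivative ?J r *v (a - b)) (at r within {0..1})"
    if "r \<in> {0..1}" for r
  proof -
    have "(g has_vector_derivative (a - b)) (at r within {0..1})"
      unfolding g_def by (auto intro!: derivative_eq_intros simp: algebra_simps)
    moreover have "(f has_derivative (\<lambda>h. ?J r *v h)) (at (g r))"
      using U gU[OF that] jacobian_works differentiable_on_eq_differentiable_at by blast
    ultimately show ?thesis
      by (rule vector_derivative_diff_chain_within[OF _ has_derivative_at_withinI])
  qed
  have "((\<lambda>r. ?J r *v (a - b)) has_integral (f \<circ> g) 1 - (f \<circ> g) 0) {0..1}"
    by (rule fundamental_theorem_of_calculus[OF _ deriv]) auto
  then have "f a - f b = integral {0..1} (\<lambda>r. ?J r *v (a - b))"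
    by (simp add: g_def has_integral_iff)
  also have "\<dots> = integral {0..1} ?J *v (a - b)"
  proof -
    have "continuous_on {0..1} ?J"
      by (rule continuous_on_compose2[OF U(3)])
        (use gU in \<open>auto simp: g_def intro!: continuous_intros\<close>)
    then have "?J integrable_on {0..1}" by (rule integrable_continuous_interval)
    moreover have "linear (\<lambda>M. M *v (a - b))"
      by (intro linearI) (auto simp: matrix_vector_mult_add_rdistrib scaleR_matrix_vector_assoc)
    then have "bounded_linear (\<lambda>M. M *v (a - b))"
      by (simp add: linear_conv_bounded_linear)
    ultimately show ?thesis by (auto dest: integral_linear simp: o_def)
  qed
  finally show ?thesis by (simp add: g_def)
qed

theorem corollary4:
  fixes f :: "real ^ 'n::{finite,linorder} \<Rightarrow> real ^ 'n::{finite,linorder}"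
    and \<Omega> U :: "(real ^ 'n::{finite,linorder}) set"
    and x :: "nat \<Rightarrow> real ^ 'n::{finite,linorder}"
  assumes "open U" and "\<Omega> \<subseteq> U"
    and "f differentiable_on U"
    and "continuous_on U (\<lambda>y. jacobian f (at y))"
    and "convex \<Omega>" and "compact \<Omega>"
    and "f ` \<Omega> \<subseteq> \<Omega>"
    and "\<And>a b. a \<in> \<Omega> \<Longrightarrow> b \<in> \<Omega> \<Longrightarrow>
           totally_positive
             (integral {0..1} (\<lambda>r::real. jacobian f (at (r *\<^sub>R a + (1 - r) *\<^sub>R b))))"
    and "x 0 \<in> \<Omega>"
    and "\<And>i. x (Suc i) = f (x i)"
  shows "\<exists>e\<in>\<Omega>. f e = e \<and> x \<longlonglongrightarrow> e"
proof -
  let ?e = "Min UNIV :: 'n"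
  define D where "D a b = integral {0..1} (\<lambda>r::real. jacobian f (at (r *\<^sub>R a + (1 - r) *\<^sub>R b)))"
    for a b
  have TP: "totally_positive (D a b)" if "a \<in> \<Omega>" "b \<in> \<Omega>" for a b
    unfolding D_def using assms(8) that by blast
  have D: "f a - f b = D a b *v (a - b)" if "a \<in> \<Omega>" "b \<in> \<Omega>" for a b
  proof -
    have "closed_segment b a \<subseteq> U"
      using closed_segment_subset[of b \<Omega> a] that assms(2,5) by blast
    then show ?thesis
      unfolding D_def using mean_value_integral_jacobian assms(1,3,4) by blast
  qed
  have cont: "continuous_on \<Omega> f"
    using assms(2,3) differentiable_imp_continuous_on continuous_on_subset by blast
  have orbit: "y i \<in> \<Omega>" if "y 0 \<in> \<Omega>" "\<And>i. y (Suc i) = f (y i)" for y i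
    using that assms(7) by (induction i) auto
  have moving: "\<exists>\<sigma>\<in>{1, -1}. \<exists>N. \<forall>i\<ge>N. \<sigma> * (y (Suc i) $ ?e - y i $ ?e) > 0"
    if y: "y 0 \<in> \<Omega>" "\<And>i. y (Suc i) = f (y i)" and "f (y 0) \<noteq> y 0" for y
  proof -
    define z where "z i = y (Suc i) - y i" for i
    have y\<Omega>: "y i \<in> \<Omega>" for i using orbit[OF y] .
    have tp: "totally_positive (D (y (Suc i)) (y i))" for i using TP y\<Omega> by blast
    have st: "z (Suc i) = D (y (Suc i)) (y i) *v z i" for i
      using D[OF y\<Omega> y\<Omega>, of "Suc i" i] y(2) by (simp add: z_def)
    have "z 0 \<noteq> 0" using that by (simp add: z_def)
    then obtain \<sigma> N where \<sigma>: "\<sigma> \<in> {1, -1}" "\<And>i. N \<le> i \<Longrightarrow> \<sigma> * z i $ ?e > 0"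
      using first_coordinate_eventually_signed[of "\<lambda>i. D (y (Suc i)) (y i)" z, OF tp st] by blast
    then have "\<forall>i\<ge>N. \<sigma> * (y (Suc i) $ ?e - y i $ ?e) > 0" by (simp add: z_def)
    with \<sigma>(1) show ?thesis by blast
  qed
  have separated: "p = q" if "p \<in> \<Omega>" "q \<in> \<Omega>" "f p = p" "f q = q" "p $ ?e = q $ ?e" for p q
  proof (rule ccontr)
    assume "p \<noteq> q"
    then have "p - q \<noteq> 0" by simp
    moreover have tp: "totally_positive (D p q)" using TP that by blast
    moreover have "p - q = D p q *v (p - q)" using D[of p q] that by simp
    \<comment> \<open>The sign lemma is applied to the constant sequence \<open>p - q\<close>, which
      \<open>D p q\<close> fixes.\<close>
    ultimately obtain \<sigma> N where "\<sigma> \<in> {1, -1}" "\<And>i::nat. N \<le> i \<Longrightarrow> \<sigma> * (p - q) $ ?e > 0"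
      using first_coordinate_eventually_signed[of "\<lambda>_. D p q" "\<lambda>_. p - q"] tp by blast
    then show False using that(5) by auto
  qed
  note x\<Omega> = orbit[of x, OF assms(9,10)]
  have "convergent (\<lambda>i. x i $ ?e)"
  proof (cases "f (x 0) = x 0")
    case True
    then have const: "x i = x 0" for i using assms(10) by (induction i) auto
    have "(\<lambda>i. x i $ ?e) = (\<lambda>i. x 0 $ ?e)" by (rule ext) (metis const)
    then show ?thesis by (simp add: convergent_const)
  next
    case False
    then obtain \<sigma> :: real and N where \<sigma>: "\<sigma> \<in> {1, -1}"
      "\<And>i. N \<le> i \<Longrightarrow> \<sigma> * (x (Suc i) $ ?e - x i $ ?e) > 0"
      using moving[of x, OF assms(9,10)] by blast
    let ?s = "\<lambda>i. x (i + N) $ ?e"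
    have "incseq ?s \<or> decseq ?s"
      using \<sigma> by (auto simp: incseq_Suc_iff decseq_Suc_iff less_imp_le)
    then have "monoseq ?s" by (auto simp: monoseq_iff)
    moreover have "Bseq ?s"
    proof -
      obtain B where "\<And>y. y \<in> \<Omega> \<Longrightarrow> norm y \<le> B"
        using compact_imp_bounded[OF assms(6)] by (auto simp: bounded_iff)
      then have "norm (?s i) \<le> B" for i
        using x\<Omega> Finite_Cartesian_Product.norm_nth_le[of "x (i + N)" ?e] by (meson order_trans)
      then show ?thesis by (rule BseqI')
    qed
    ultimately have "convergent ?s" by (intro Bseq_monoseq_convergent)
    then show ?thesis using convergent_ignore_initial_segment[of "\<lambda>i. x i $ ?e" N] by simp
  qed
  then obtain L where L: "(\<lambda>i. x i $ ?e) \<longlonglongrightarrow> L" by (auto simp: convergent_def)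
  have limit_point: "f p = p \<and> p $ ?e = L"
    if p: "p \<in> \<Omega>" and s: "strict_mono s" "(x \<circ> s) \<longlonglongrightarrow> p" for p s
  proof -
    define y where "y i = (f ^^ i) p" for i
    have y0: "y 0 = p" and ySuc: "\<And>i. y (Suc i) = f (y i)" by (auto simp: y_def)
    have y\<Omega>: "y i \<in> \<Omega>" for i using orbit[of y] y0 ySuc p by auto
    \<comment> \<open>By continuity, shifting the subsequence by \<open>i\<close> moves its limit
      \<open>i\<close> steps along the orbit of \<open>p\<close>.\<close>
    have lim: "(\<lambda>j. x (s j + i)) \<longlonglongrightarrow> y i" for i
    proof (induction i)
      case 0
      then show ?case using s(2) by (simp add: o_def y0)
    next
      case (Suc i)
      then have "(\<lambda>j. f (x (s j + i))) \<longlonglongrightarrow> f (y i)"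
        by (rule continuous_on_tendsto_compose[OF cont _ y\<Omega>]) (simp add: x\<Omega>)
      then show ?case using assms(10) ySuc by simp
    qed
    have yL: "y i $ ?e = L" for i
    proof -
      have "strict_mono (\<lambda>j. s j + i)" using s(1) by (auto simp: strict_mono_def)
      then have "(\<lambda>j. x (s j + i) $ ?e) \<longlonglongrightarrow> L"
        using LIMSEQ_subseq_LIMSEQ[OF L] by (simp add: o_def)
      then show ?thesis using LIMSEQ_unique tendsto_vec_nth[OF lim] by blast
    qed
    have "f p = p"
    proof (rule ccontr)
      assume "f p \<noteq> p"
      then obtain \<sigma> N where "\<And>i. N \<le> i \<Longrightarrow> \<sigma> * (y (Suc i) $ ?e - y i $ ?e) > 0"
        using moving[of y] y0 ySuc p by metis
      then show False by (auto simp: yL)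
    qed
    then show ?thesis using yL[of 0] y0 by simp
  qed
  \<comment> \<open>Stated for any \<open>r\<close>: the identity gives the candidate
    \<open>e\<close>, and a subsequence staying away from \<open>e\<close> gives the
    contradiction.\<close>
  have subseq: "\<exists>p\<in>\<Omega>. \<exists>s. strict_mono s \<and> (x \<circ> r \<circ> s) \<longlonglongrightarrow> p" for r :: "nat \<Rightarrow> nat"
    using assms(6) x\<Omega> unfolding compact_def by (metis comp_apply)
  obtain e s where e: "e \<in> \<Omega>" "strict_mono s" "(x \<circ> s) \<longlonglongrightarrow> e"
    using subseq[of id] by auto
  note fe = limit_point[OF e]
  have "x \<longlonglongrightarrow> e"
  proof (rule ccontr)
    assume "\<not> x \<longlonglongrightarrow> e"
    then obtain \<epsilon> where \<epsilon>: "\<epsilon> > 0" "\<not> (\<forall>\<^sub>F i in sequentially. dist (x i) e < \<epsilon>)"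
      by (auto simp: tendsto_iff)
    obtain r :: "nat \<Rightarrow> nat" where r: "strict_mono r" "\<And>i. \<not> dist (x (r i)) e < \<epsilon>"
      using not_eventually_sequentiallyD[OF \<epsilon>(2)] by blast
    obtain q s where q: "q \<in> \<Omega>" "strict_mono s" "(x \<circ> r \<circ> s) \<longlonglongrightarrow> q"
      using subseq by blast
    have "f q = q \<and> q $ ?e = L"
      using limit_point[of q "r \<circ> s"] q r(1) by (simp add: strict_mono_o o_assoc)
    then have "q = e" using separated q(1) e(1) fe by metis
    then have "\<forall>\<^sub>F i in sequentially. dist ((x \<circ> r \<circ> s) i) e < \<epsilon>"
      using q(3) \<epsilon>(1) tendstoD by blast
    then show False using r(2) by (auto simp: eventually_sequentially)
  qed
  then show ?thesis using e(1) fe by blast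
qed

end
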